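(* Let $\mathcal{X}$ be a finite non-empty set, let $A\subset\mathcal{X}$, $A^c=\mathcal{X}\setminus A$, and let $\mathcal{T}$ be a non-empty, closed, convex set of transition matrices on $\mathcal{X}$ that has separately specified rows, with lower and upper transition operators $\underline{T}$ and $\overline{T}$. Consider an imprecise Markov chain characterised by $\mathcal{T}$, of any of the three types $\star\in\{\mathrm{H},\mathrm{I},\mathrm{V}\}$, and let $\underline{p}_A(x)=\underline{\mathbb{E}}_{\mathcal{T}}^{\star}[G_A\,|\,X_0=x]$ and $\overline{p}_A(x)=\overline{\mathbb{E}}_{\mathcal{T}}^{\star}[G_A\,|\,X_0=x]$ for $x\in\mathcal{X}$ be its vectors of lower and upper hitting probabilities, which belong to $\mathcal{L}(\mathcal{X})$. Then $\underline{p}_A$ is the minimal non-negative solution in $\mathcal{L}(\mathcal{X})$ to $$\underline{p}_A=\mathbb{I}_{A}+\mathbb{I}_{A^c}\cdot\underline{T}\,\underline{p}_A,$$ and $\overline{p}_A$ is the minimal non-negative solution in $\mathcal{L}(\mathcal{X})$ to $$\overline{p}_A=\mathbb{I}_{A}+\mathbb{I}_{A^c}\cdot\overline{T}\,\overline{p}_A.$$ Here $p$ being the minimal non-negative solution means that $p$ is a non-negative solution and $p(x)\le g(x)$ for all $x\in\mathcal{X}$ and every non-negative solution $g\in\mathcal{L}(\mathcal{X})$ of the same equation.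
   Context: Conventions. $\mathbb{N}_0=\{0,1,2,\dots\}$; $0\cdot(+\infty)=0\cdot(-\infty)=0$. $\mathcal{L}(\mathcal{X})$ is the set of functions $\mathcal{X}\to\mathbb{R}$ and $\mathcal{L}^{+\infty}(\mathcal{X})$ is the set of functions $\mathcal{X}\to\mathbb{R}\cup\{+\infty\}$. $\mathbb{I}_B$ is the indicator of $B\subseteq\mathcal{X}$, and $f\cdot g$ is the pointwise product. Transition matrices. A transition matrix on $\mathcal{X}$ is a row-stochastic $|\mathcal{X}|\times|\mathcal{X}|$ matrix $T$; it acts on $f\in\mathcal{L}^{+\infty}(\mathcal{X})$ by $[Tf](x)=\sum_{y}T(x,y)f(y)$. A set $\mathcal{T}$ of transition matrices has separately specified rows if, for every choice of $T_x\in\mathcal{T}$ ($x\in\mathcal{X}$), there is a $T\in\mathcal{T}$ with $T(x,\cdot)=T_x(x,\cdot)$ for all $x\in\mathcal{X}$. The lower and upper transition operators are $[\underline{T}f](x)=\inf_{T\in\mathcal{T}}[Tf](x)$ and $[\overline{T}f](x)=\sup_{T\in\mathcal{T}}[Tf](x)$ for $f\in\mathcal{L}^{+\infty}(\mathcal{X})$. Stochastic processes. $\Omega$ is the set of all paths $\omega:\mathbb{N}_0\to\mathcal{X}$, with the $\sigma$-algebra generated by the cylinder sets, and $X_n(\omega)=\omega(n)$; $X_{0:n}=(X_0,\dots,X_n)$, $x_{0:n}=(x_0,\dots,x_n)$. A stochastic process $P$ is a probability measure on $\Omega$; it is understood as given by an initial mass function together with conditional mass functions $P(X_{n+1}=\cdot\,|\,X_{0:n}=x_{0:n})$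 specified for every $n\in\mathbb{N}_0$ and every $x_{0:n}\in\mathcal{X}^{n+1}$, and $P(\cdot\,|\,X_{0:n}=x_{0:n})$ is the corresponding probability measure on paths starting with $x_{0:n}$, with $\mathbb{E}_P[\cdot\,|\,X_{0:n}=x_{0:n}]$ its expectation. $P$ is a homogeneous Markov chain with transition matrix $T$ if $P(X_{n+1}=y\,|\,X_{0:n}=x_{0:n})=T(x_n,y)$ for all $n,x_{0:n},y$. Imprecise Markov chains. $\mathcal{P}_{\mathcal{T}}^{\mathrm{H}}$ is the set of all homogeneous Markov chains whose transition matrix belongs to $\mathcal{T}$. $\mathcal{P}_{\mathcal{T}}^{\mathrm{I}}$ is the set of all stochastic processes $P$ such that for all $n$ and $x_{0:n}$ there is a $T\in\mathcal{T}$ with $P(X_{n+1}=y\,|\,X_{0:n}=x_{0:n})=T(x_n,y)$ for all $y\in\mathcal{X}$. For $\star\in\{\mathrm{H},\mathrm{I}\}$, $\underline{\mathbb{E}}_{\mathcal{T}}^{\star}[\cdot|\cdot]=\inf_{P\in\mathcal{P}_{\mathcal{T}}^{\star}}\mathbb{E}_P[\cdot|\cdot]$ and $\overline{\mathbb{E}}_{\mathcal{T}}^{\star}[\cdot|\cdot]=\sup_{P\in\mathcal{P}_{\mathcal{T}}^{\star}}\mathbb{E}_P[\cdot|\cdot]$. Game-theoretic imprecise Markov chain ($\star=\mathrm{V}$). Let $\mathbb{S}=\{x_{0:n}\in\mathcal{X}^{n+1}:n\in\mathbb{N}_0\}$ be the set of situations and $\Box$ the empty string. Put $\overline{Q}_{x_{0:n}}(f)=[\overline{T}f](x_n)$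 for $f\in\mathcal{L}^{+\infty}(\mathcal{X})$; $\overline{Q}_\Box:\mathcal{L}^{+\infty}(\mathcal{X})\to\mathbb{R}\cup\{+\infty\}$ is any operator that maps real constants to themselves, is subadditive, monotone, and satisfies $\overline{Q}_\Box(\lambda f)=\lambda\overline{Q}_\Box(f)$ for all positive $\lambda\in\mathbb{R}\cup\{+\infty\}$ and non-negative $f$ (its choice does not affect what follows). A supermartingale is a map $\mathcal{M}:\mathbb{S}\cup\{\Box\}\to\mathbb{R}\cup\{-\infty,+\infty\}$ that is uniformly bounded below by a real number and satisfies $\overline{Q}_s(\mathcal{M}(s\,\cdot))\le\mathcal{M}(s)$ for all $s$, where $\mathcal{M}(s\,\cdot)$ is the function $x\mapsto\mathcal{M}(sx)$. For $f:\Omega\to\mathbb{R}\cup\{\pm\infty\}$ and $s=x_{0:n}$, $\overline{\mathbb{E}}_{\mathcal{T}}^{\mathrm{V}}[f\,|\,X_{0:n}=x_{0:n}]$ is the infimum of $\mathcal{M}(s)$ over all supermartingales $\mathcal{M}$ such that $\liminf_{m\to+\infty}\mathcal{M}(\omega(0),\dots,\omega(m))\ge f(\omega)$ for every path $\omega$ with $(\omega(0),\dots,\omega(n))=x_{0:n}$. The lower expectation is $\underline{\mathbb{E}}_{\mathcal{T}}^{\mathrm{V}}[f|\cdot]=-\overline{\mathbb{E}}_{\mathcal{T}}^{\mathrm{V}}[-f|\cdot]$. Hitting indicator. $G_A:\Omega\to\{0,1\}$ is defined by $G_A(\omega)=1$ if $\omega(t)\in A$ for some $t\in\mathbb{N}_0$,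 and $G_A(\omega)=0$ otherwise. *)

theory Defs
  imports "HOL-Analysis.Analysis" "HOL-Probability.Probability"
begin

section \<open>Transition matrices and transition operators\<close>

definition transition_matrix :: "real^'x::finite^'x \<Rightarrow> bool" where
  "transition_matrix T \<longleftrightarrow> (\<forall>x y. 0 \<le> T $ x $ y) \<and> (\<forall>x. (\<Sum>y\<in>UNIV. T $ x $ y) = 1)"

definition separately_specified_rows :: "(real^'x::finite^'x) set \<Rightarrow> bool" where
  "separately_specified_rows \<T> \<longleftrightarrow>
     (\<forall>R. (\<forall>x. R x \<in> \<T>) \<longrightarrow> (\<exists>T\<in>\<T>. \<forall>x. T $ x = R x $ x))"

text \<open>
  Functions on the state space take values in \<^typ>\<open>ereal\<close>; the two sets below carve out the
  real-valued functions and the functions that avoid \<open>-\<infinity>\<close>.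
\<close>

definition real_functions :: "('x \<Rightarrow> ereal) set" where
  "real_functions = {f. \<forall>x. f x \<noteq> -\<infinity> \<and> f x \<noteq> \<infinity>}"

definition pinf_functions :: "('x \<Rightarrow> ereal) set" where
  "pinf_functions = {f. \<forall>x. f x \<noteq> -\<infinity>}"

text \<open>The convention \<open>0 * \<infinity> = 0\<close> used below is built into \<^typ>\<open>ereal\<close>.\<close>

definition trans_op :: "real^'x::finite^'x \<Rightarrow> ('x \<Rightarrow> ereal) \<Rightarrow> 'x \<Rightarrow> ereal" where
  "trans_op T f x = (\<Sum>y\<in>UNIV. ereal (T $ x $ y) * f y)"

definition lower_trans :: "(real^'x::finite^'x) set \<Rightarrow> ('x \<Rightarrow> ereal) \<Rightarrow> 'x \<Rightarrow> ereal" where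
  "lower_trans \<T> f x = (INF T\<in>\<T>. trans_op T f x)"

definition upper_trans :: "(real^'x::finite^'x) set \<Rightarrow> ('x \<Rightarrow> ereal) \<Rightarrow> 'x \<Rightarrow> ereal" where
  "upper_trans \<T> f x = (SUP T\<in>\<T>. trans_op T f x)"


section \<open>Stochastic processes\<close>

text \<open>
  A situation \<open>x\<^sub>0, \<dots>, x\<^sub>n\<close> is a non-empty list; \<open>[]\<close> plays the role of the empty string. A process
  maps \<open>[]\<close> to its initial mass function, and every situation to the conditional mass function
  of the next state, including situations of probability zero.
\<close>

type_synonym 'x process = "'x list \<Rightarrow> 'x pmf"

definition path_prefix :: "nat \<Rightarrow> (nat \<Rightarrow> 'x) \<Rightarrow> 'x list" where
  "path_prefix n \<omega> = map \<omega> [0..<n]"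

definition kernel :: "'x process \<Rightarrow> nat \<Rightarrow> (nat \<Rightarrow> 'x) \<Rightarrow> 'x measure" where
  "kernel P i \<omega> = measure_pmf (P (path_prefix i \<omega>))"

global_interpretation path: Ionescu_Tulcea "kernel (P :: 'x::finite process)" "\<lambda>_. count_space UNIV"
  for P
proof (rule Ionescu_Tulcea.intro)
  show "kernel P i \<in> PiM {0..<i} (\<lambda>_. count_space UNIV) \<rightarrow>\<^sub>M subprob_algebra (count_space UNIV)" for i
    by (simp add: count_space_PiM_finite kernel_def space_subprob_algebra
        prob_space_imp_subprob_space measure_pmf.prob_space_axioms)
  show "prob_space (kernel P i x)" for i x
    by (simp add: kernel_def measure_pmf.prob_space_axioms)
qed

text \<open>
  The law of the process: the measure on the product \<open>\<sigma>\<close>-algebra obtained from the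
  Ionescu-Tulcea theorem, determined by the cylinder probabilities in \<open>emeasure_cylinder\<close>.
\<close>

definition path_measure :: "'x::finite process \<Rightarrow> (nat \<Rightarrow> 'x) measure" where
  "path_measure P = path.PF.lim P"

lemma sets_path_measure:
  "sets (path_measure (P :: 'x::finite process)) = sets (PiM UNIV (\<lambda>_. count_space UNIV))"
  by (simp add: path_measure_def)

lemma emeasure_cylinder:
  "emeasure (path_measure P) {\<omega>. path_prefix (length s) \<omega> = s} =
     ennreal (\<Prod>i<length s. pmf (P (take i s)) (s ! i))"
proof -
  have fin: "emeasure (path.C P 0 (length s) (\<lambda>_. undefined))
        {\<omega> \<in> PiE {0..<length s} (\<lambda>_. UNIV). path_prefix (length s) \<omega> = s} =
      ennreal (\<Prod>i<length s. pmf (P (take i s)) (s ! i))" for s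
  proof (induction s rule: rev_induct)
    case Nil
    show ?case by (simp add: path_prefix_def PiM_empty)
  next
    case (snoc y s)
    let ?n = "length s" and ?u = "\<lambda>_. undefined :: 'a"
    let ?X = "{\<omega> \<in> PiE {0..<Suc ?n} (\<lambda>_. UNIV). path_prefix (Suc ?n) \<omega> = s @ [y]}"
    let ?Y = "{\<omega> \<in> PiE {0..<?n} (\<lambda>_. UNIV). path_prefix ?n \<omega> = s}"
    have sp: "space (path.C P 0 ?n ?u) = PiE {0..<?n} (\<lambda>_. UNIV)"
      by (subst path.space_C) (auto simp: space_PiM)
    have X: "?X \<in> sets (PiM {0..<Suc ?n} (\<lambda>_. count_space UNIV))"
      by (subst count_space_PiM_finite) auto
    have Y: "?Y \<in> sets (path.C P 0 ?n ?u)"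
      by (subst path.sets_C) (auto simp: space_PiM count_space_PiM_finite)
    have step: "emeasure (path.eP P ?n \<omega>) ?X = ennreal (pmf (P s) y) * indicator ?Y \<omega>"
      if \<omega>: "\<omega> \<in> PiE {0..<?n} (\<lambda>_. UNIV)" for \<omega>
    proof -
      have "emeasure (path.eP P ?n \<omega>) ?X = emeasure (kernel P ?n \<omega>) (fun_upd \<omega> ?n -` ?X)"
        using \<omega> X by (subst path.emeasure_eP) (auto simp: space_PiM)
      also have "fun_upd \<omega> ?n -` ?X = (if path_prefix ?n \<omega> = s then {y} else {})"
        using \<omega> by (auto simp: path_prefix_def PiE_iff extensional_def )
      also have "emeasure (kernel P ?n \<omega>) \<dots> = ennreal (pmf (P s) y) * indicator ?Y \<omega>"
        using \<omega> by (auto simp: kernel_def emeasure_pmf_single)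
      finally show ?thesis .
    qed
    have "emeasure (path.C P 0 (Suc ?n) ?u) ?X =
        (\<integral>\<^sup>+\<omega>. emeasure (path.eP P ?n \<omega>) ?X \<partial>path.C P 0 ?n ?u)"
      using path.measurable_eP[of P ?n] X
      by (simp, subst emeasure_bind[where N = "PiM {0..<Suc ?n} (\<lambda>_. count_space UNIV)"])
        (auto simp: sp measurable_cong_sets[OF path.sets_C])
    also have "\<dots> = (\<integral>\<^sup>+\<omega>. ennreal (pmf (P s) y) * indicator ?Y \<omega> \<partial>path.C P 0 ?n ?u)"
      by (intro nn_integral_cong step) (simp add: sp)
    also have "\<dots> = ennreal (pmf (P s) y) * emeasure (path.C P 0 ?n ?u) ?Y"
      using Y by (simp add: nn_integral_cmult)
    finally show ?case
      using snoc.IH by (simp add: nth_append ennreal_mult' mult.commute prod_nonneg)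
  qed
  let ?J = "{0..<length s}"
  let ?Y = "{\<omega> \<in> PiE ?J (\<lambda>_. UNIV). path_prefix (length s) \<omega> = s}"
  have Y: "?Y \<in> sets (PiM ?J (\<lambda>_. count_space UNIV))"
    by (subst count_space_PiM_finite) auto
  have "path_prefix (length s) (restrict \<omega> ?J) = path_prefix (length s) \<omega>" for \<omega> :: "nat \<Rightarrow> 'a"
    by (simp add: path_prefix_def)
  then have "{\<omega>. path_prefix (length s) \<omega> = s} = path.PF.emb UNIV ?J ?Y"
    by (auto simp: prod_emb_def space_PiM)
  then have "emeasure (path_measure P) {\<omega>. path_prefix (length s) \<omega> = s} = emeasure (path.CI P ?J) ?Y"
    unfolding path_measure_def using path.lim[of ?J ?Y P] Y by simp
  also have "\<dots> = emeasure (path.C P 0 (length s) (\<lambda>_. undefined)) (path.PF.emb ?J ?J ?Y)"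
    by (rule path.emeasure_CI[OF subset_refl Y])
  also have "path.PF.emb ?J ?J ?Y = ?Y"
    by (rule prod_emb_id) (auto simp: space_PiM)
  finally show ?thesis
    using fin[of s] by (rule trans)
qed

text \<open>
  Conditioning on a situation \<open>s\<close>: the process is forced through \<open>s\<close>, and follows the
  conditional mass functions of \<open>P\<close> from there on.
\<close>

definition condition :: "'x process \<Rightarrow> 'x list \<Rightarrow> 'x process" where
  "condition P s = (\<lambda>u. if length u < length s then return_pmf (s ! length u) else P u)"

text \<open>Only meant for bounded measurable \<open>f\<close>.\<close>

definition cond_expectation :: "'x::finite process \<Rightarrow> ((nat \<Rightarrow> 'x) \<Rightarrow> real) \<Rightarrow> 'x list \<Rightarrow> real" where
  "cond_expectation P f s = integral\<^sup>L (path_measure (condition P s)) f"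

definition homogeneous_chain :: "real^'x::finite^'x \<Rightarrow> 'x process \<Rightarrow> bool" where
  "homogeneous_chain T P \<longleftrightarrow> (\<forall>s. s \<noteq> [] \<longrightarrow> (\<forall>y. pmf (P s) y = T $ last s $ y))"

definition processes_H :: "(real^'x::finite^'x) set \<Rightarrow> 'x process set" where
  "processes_H \<T> = {P. \<exists>T\<in>\<T>. homogeneous_chain T P}"

definition processes_I :: "(real^'x::finite^'x) set \<Rightarrow> 'x process set" where
  "processes_I \<T> = {P. \<forall>s. s \<noteq> [] \<longrightarrow> (\<exists>T\<in>\<T>. \<forall>y. pmf (P s) y = T $ last s $ y)}"


section \<open>Game-theoretic upper expectations\<close>

definition initial_upper_operator :: "(('x \<Rightarrow> ereal) \<Rightarrow> ereal) \<Rightarrow> bool" where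
  "initial_upper_operator Q \<longleftrightarrow>
     (\<forall>f\<in>pinf_functions. Q f \<noteq> -\<infinity>) \<and>
     (\<forall>c::real. Q (\<lambda>_. ereal c) = ereal c) \<and>
     (\<forall>f\<in>pinf_functions. \<forall>g\<in>pinf_functions. Q (\<lambda>x. f x + g x) \<le> Q f + Q g) \<and>
     (\<forall>f\<in>pinf_functions. \<forall>g\<in>pinf_functions. (\<forall>x. f x \<le> g x) \<longrightarrow> Q f \<le> Q g) \<and>
     (\<forall>c>0. \<forall>f\<in>pinf_functions. (\<forall>x. 0 \<le> f x) \<longrightarrow> Q (\<lambda>x. c * f x) = c * Q f)"

definition local_upper ::
  "(('x \<Rightarrow> ereal) \<Rightarrow> ereal) \<Rightarrow> (real^'x::finite^'x) set \<Rightarrow> 'x list \<Rightarrow> ('x \<Rightarrow> ereal) \<Rightarrow> ereal" where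
  "local_upper Q \<T> s f = (if s = [] then Q f else upper_trans \<T> f (last s))"

definition supermartingale ::
  "(('x \<Rightarrow> ereal) \<Rightarrow> ereal) \<Rightarrow> (real^'x::finite^'x) set \<Rightarrow> ('x list \<Rightarrow> ereal) \<Rightarrow> bool" where
  "supermartingale Q \<T> M \<longleftrightarrow>
     (\<exists>b::real. \<forall>s. ereal b \<le> M s) \<and> (\<forall>s. local_upper Q \<T> s (\<lambda>x. M (s @ [x])) \<le> M s)"

definition upper_expectation_V ::
  "(('x \<Rightarrow> ereal) \<Rightarrow> ereal) \<Rightarrow> (real^'x::finite^'x) set \<Rightarrow> ((nat \<Rightarrow> 'x) \<Rightarrow> ereal) \<Rightarrow> 'x list \<Rightarrow> ereal"
  where
  "upper_expectation_V Q \<T> f s =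
     Inf {M s | M. supermartingale Q \<T> M \<and>
       (\<forall>\<omega>. path_prefix (length s) \<omega> = s \<longrightarrow> f \<omega> \<le> liminf (\<lambda>m. M (path_prefix (Suc m) \<omega>)))}"

definition lower_expectation_V ::
  "(('x \<Rightarrow> ereal) \<Rightarrow> ereal) \<Rightarrow> (real^'x::finite^'x) set \<Rightarrow> ((nat \<Rightarrow> 'x) \<Rightarrow> ereal) \<Rightarrow> 'x list \<Rightarrow> ereal"
  where
  "lower_expectation_V Q \<T> f s = - upper_expectation_V Q \<T> (\<lambda>\<omega>. - f \<omega>) s"


section \<open>Imprecise Markov chains and hitting probabilities\<close>

datatype chain_type = Type_H | Type_I | Type_V

text \<open>The operator \<open>Q\<close> is only relevant for \<^const>\<open>Type_V\<close>.\<close>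

fun upper_expectation ::
  "chain_type \<Rightarrow> (('x \<Rightarrow> ereal) \<Rightarrow> ereal) \<Rightarrow> (real^'x::finite^'x) set \<Rightarrow>
     ((nat \<Rightarrow> 'x) \<Rightarrow> real) \<Rightarrow> 'x list \<Rightarrow> ereal" where
  "upper_expectation Type_H Q \<T> f s = (SUP P\<in>processes_H \<T>. ereal (cond_expectation P f s))"
| "upper_expectation Type_I Q \<T> f s = (SUP P\<in>processes_I \<T>. ereal (cond_expectation P f s))"
| "upper_expectation Type_V Q \<T> f s = upper_expectation_V Q \<T> (\<lambda>\<omega>. ereal (f \<omega>)) s"

fun lower_expectation ::
  "chain_type \<Rightarrow> (('x \<Rightarrow> ereal) \<Rightarrow> ereal) \<Rightarrow> (real^'x::finite^'x) set \<Rightarrow>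
     ((nat \<Rightarrow> 'x) \<Rightarrow> real) \<Rightarrow> 'x list \<Rightarrow> ereal" where
  "lower_expectation Type_H Q \<T> f s = (INF P\<in>processes_H \<T>. ereal (cond_expectation P f s))"
| "lower_expectation Type_I Q \<T> f s = (INF P\<in>processes_I \<T>. ereal (cond_expectation P f s))"
| "lower_expectation Type_V Q \<T> f s = lower_expectation_V Q \<T> (\<lambda>\<omega>. ereal (f \<omega>)) s"

definition hitting_indicator :: "'x set \<Rightarrow> (nat \<Rightarrow> 'x) \<Rightarrow> real" where
  "hitting_indicator A \<omega> = (if \<exists>t. \<omega> t \<in> A then 1 else 0)"

lemma measurable_hitting_indicator:
  "hitting_indicator A \<in> borel_measurable (path_measure (P :: 'x::finite process))"
proof -
  have "hitting_indicator A \<in> borel_measurable (PiM UNIV (\<lambda>_. count_space (UNIV :: 'x set)))"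
    unfolding hitting_indicator_def[abs_def] by measurable
  then show ?thesis
    by (simp add: measurable_cong_sets[OF sets_path_measure refl])
qed

definition lower_hitting_prob ::
  "chain_type \<Rightarrow> (('x \<Rightarrow> ereal) \<Rightarrow> ereal) \<Rightarrow> (real^'x::finite^'x) set \<Rightarrow> 'x set \<Rightarrow> 'x \<Rightarrow> ereal" where
  "lower_hitting_prob \<tau> Q \<T> A x = lower_expectation \<tau> Q \<T> (hitting_indicator A) [x]"

definition upper_hitting_prob ::
  "chain_type \<Rightarrow> (('x \<Rightarrow> ereal) \<Rightarrow> ereal) \<Rightarrow> (real^'x::finite^'x) set \<Rightarrow> 'x set \<Rightarrow> 'x \<Rightarrow> ereal" where
  "upper_hitting_prob \<tau> Q \<T> A x = upper_expectation \<tau> Q \<T> (hitting_indicator A) [x]"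

definition minimal_nonneg_solution ::
  "(('x \<Rightarrow> ereal) \<Rightarrow> 'x \<Rightarrow> ereal) \<Rightarrow> ('x \<Rightarrow> ereal) \<Rightarrow> bool" where
  "minimal_nonneg_solution F p \<longleftrightarrow>
     p \<in> real_functions \<and> (\<forall>x. 0 \<le> p x) \<and> (\<forall>x. p x = F p x) \<and>
     (\<forall>g\<in>real_functions. (\<forall>x. 0 \<le> g x) \<and> (\<forall>x. g x = F g x) \<longrightarrow> (\<forall>x. p x \<le> g x))"

end

theory Submission
  imports Defs
begin

text \<open>
  On real-valued functions the lower and upper transition operators are monotone and commute with
  adding constants. Iterating \<open>h \<mapsto> \<I>\<^sub>A + \<I>\<^bsub>- A\<^esub> \<cdot> F h\<close> from \<open>\<I>\<^sub>A\<close>, for either operator \<open>F\<close>, gives an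
  increasing sequence \<open>h\<^sub>n\<close> below every non-negative solution (\<open>reach_le_supersolution\<close>), and its limit
  is a solution (\<open>reach_limit_fixed_point\<close>). The limit is therefore the minimal non-negative solution,
  and what remains is to identify it with the hitting probabilities of all three types of chain.

  One sandwich does this for the three types at once. Every homogeneous chain is a process compatible
  with \<open>\<T>\<close>, and by Fatou's lemma the expectation under such a process is at most the
  initial value of any supermartingale whose limit inferior dominates the function
  (\<open>cond_expectation_le_supermartingale\<close>). Hence game-theoretic upper probabilities
  dominate those of the compatible processes, which dominate those of the homogeneous chains, and
  dually for lower ones. It suffices to bound the game-theoretic end from outside, by explicit
  supermartingales, and the homogeneous end from inside, by explicit chains.

  For the game-theoretic upper probability, follow the limit \<open>p\<close> evaluated at the current state until
  \<open>A\<close> is visited, and then stay at 1. For the lower one, the analogous process \<open>- p\<close> fails: on a path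
  that avoids \<open>A\<close> it need not tend to 0. A finite horizon repairs this: using \<open>- h\<^sub>k\<close> with \<open>k\<close> the
  number of remaining steps gives the bound \<open>h\<^sub>n\<close> for every horizon \<open>n\<close>, and then \<open>n \<rightarrow> \<infinity>\<close>.

  For the lower probability of homogeneous chains, choose a matrix of \<open>\<T>\<close> that minimises every row
  against \<open>p\<close>; it exists by compactness and separate specification of the rows. Then \<open>p\<close> solves the
  hitting equation of that matrix and so dominates its hitting probability. The same choice does
  not work for the upper probability: a maximising matrix may idle forever in a set of states where
  \<open>p\<close> is constant. Discounting every step by a factor \<open>c < 1\<close> penalises idling. A matrix that is
  optimal for the discounted equation has hitting probabilities at least as large as the discounted
  solution (\<open>discounted_chain_attained\<close>), and the latter is at least \<open>c\<^sup>n h\<^sub>n\<close>; first \<open>c \<rightarrow> 1\<close> and then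
  \<open>n \<rightarrow> \<infinity>\<close> gives the supremum.
\<close>

section \<open>Least fixed points of averaging operators\<close>

text \<open>
  The properties shared by the lower and the upper transition operator. Monotonicity and
  translation invariance give continuity along monotone sequences on the finite state space, and
  scaling with a non-negative factor lets discount factors be pulled out.
\<close>

locale average_operator =
  fixes F :: "('x::finite \<Rightarrow> real) \<Rightarrow> 'x \<Rightarrow> real"
  assumes mono: "(\<And>y. f y \<le> g y) \<Longrightarrow> F f x \<le> F g x"
    and translation: "F (\<lambda>y. f y + e) x = F f x + e"
    and scaling: "0 \<le> a \<Longrightarrow> F (\<lambda>y. a * f y) x = a * F f x"

text \<open>
  Value iteration for the probability of reaching \<open>A\<close> within \<open>n\<close> steps, when the process survives
  each step with probability \<open>c\<close>. Undiscounted hitting probabilities have \<open>c = 1\<close>.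
\<close>

primrec reach :: "(('x \<Rightarrow> real) \<Rightarrow> 'x \<Rightarrow> real) \<Rightarrow> real \<Rightarrow> 'x set \<Rightarrow> nat \<Rightarrow> 'x \<Rightarrow> real" where
  "reach F c A 0 = indicator A"
| "reach F c A (Suc n) = (\<lambda>x. if x \<in> A then 1 else c * F (reach F c A n) x)"

definition reach_limit :: "(('x \<Rightarrow> real) \<Rightarrow> 'x \<Rightarrow> real) \<Rightarrow> real \<Rightarrow> 'x set \<Rightarrow> 'x \<Rightarrow> real" where
  "reach_limit F c A x = (SUP n. reach F c A n x)"

lemma reach_target: "x \<in> A \<Longrightarrow> reach F c A n x = 1"
  by (cases n) auto

context average_operator
begin

lemma const: "F (\<lambda>_. e) x = e"
  using translation[of "\<lambda>_. 0" e x] scaling[of 0 "\<lambda>_. 0" x] by simp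

lemma reach_le_supersolution:
  assumes "0 \<le> c" and g0: "\<And>x. 0 \<le> g x"
    and g: "\<And>x. (if x \<in> A then 1 else c * F g x) \<le> g x"
  shows "reach F c A n x \<le> g x"
proof (induction n arbitrary: x)
  case 0
  show ?case using g0[of x] g[of x] by (auto simp: indicator_def)
next
  case (Suc n)
  have "c * F (reach F c A n) x \<le> c * F g x"
    by (intro mult_left_mono mono Suc \<open>0 \<le> c\<close>)
  then show ?case using g[of x] by auto
qed

lemma reach_nonneg: "0 \<le> c \<Longrightarrow> 0 \<le> reach F c A n x"
proof (induction n arbitrary: x)
  case (Suc n)
  then have "F (\<lambda>_. 0) x \<le> F (reach F c A n) x" by (intro mono)
  then show ?case using \<open>0 \<le> c\<close> by (simp add: const)
qed (simp add: indicator_def)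

lemma reach_le_1:
  assumes "0 \<le> c" "c \<le> 1" shows "reach F c A n x \<le> 1"
  by (rule reach_le_supersolution) (use assms in \<open>auto simp: const\<close>)

lemma reach_Suc:
  assumes "0 \<le> c" shows "reach F c A n x \<le> reach F c A (Suc n) x"
proof (induction n arbitrary: x)
  case 0
  show ?case using reach_nonneg[OF assms, of A "Suc 0" x] by (auto simp: indicator_def)
next
  case (Suc n)
  have "F (reach F c A n) x \<le> F (reach F c A (Suc n)) x" by (intro mono Suc)
  then show ?case using assms by (auto intro: mult_left_mono)
qed

lemma reach_bdd_above:
  assumes "0 \<le> c" "c \<le> 1" shows "bdd_above (range (\<lambda>n. reach F c A n x))"
  by (rule bdd_aboveI2) (rule reach_le_1[OF assms])

lemma reach_tendsto:
  assumes "0 \<le> c" "c \<le> 1"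
  shows "(\<lambda>n. reach F c A n x) \<longlonglongrightarrow> reach_limit F c A x"
  unfolding reach_limit_def
  by (rule LIMSEQ_incseq_SUP[OF reach_bdd_above[OF assms]])
    (rule incseq_SucI, rule reach_Suc[OF assms(1)])

lemma reach_le_limit:
  assumes "0 \<le> c" "c \<le> 1"
  shows "reach F c A n x \<le> reach_limit F c A x"
  unfolding reach_limit_def by (rule cSUP_upper[OF UNIV_I reach_bdd_above[OF assms]])

lemma reach_limit_least:
  assumes "0 \<le> c" "c \<le> 1" and "\<And>x. 0 \<le> g x"
    and "\<And>x. (if x \<in> A then 1 else c * F g x) \<le> g x"
  shows "reach_limit F c A x \<le> g x"
proof (rule LIMSEQ_le_const2[OF reach_tendsto[OF assms(1,2)]])
  have "reach F c A n x \<le> g x" for n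
    by (rule reach_le_supersolution[OF assms(1,3,4)])
  then show "\<exists>N. \<forall>n\<ge>N. reach F c A n x \<le> g x" by blast
qed

lemma reach_limit_nonneg:
  "0 \<le> c \<Longrightarrow> c \<le> 1 \<Longrightarrow> 0 \<le> reach_limit F c A x"
  using reach_nonneg[of c A 0 x] reach_le_limit[of c A 0 x] by linarith

lemma reach_limit_le_1:
  "0 \<le> c \<Longrightarrow> c \<le> 1 \<Longrightarrow> reach_limit F c A x \<le> 1"
  by (rule reach_limit_least) (auto simp: const)

text \<open>
  The finiteness of the state space makes the convergence of the iterates uniform, so that the limit
  exceeds some iterate by at most a constant \<open>e\<close>, and translation invariance moves \<open>e\<close> out of the
  operator.
\<close>

lemma reach_limit_fixed_point:
  assumes c: "0 \<le> c" "c \<le> 1"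
  shows "reach_limit F c A x = (if x \<in> A then 1 else c * F (reach_limit F c A) x)"
proof (cases "x \<in> A")
  case True
  then show ?thesis by (simp add: reach_limit_def reach_target)
next
  case False
  let ?p = "reach_limit F c A"
  have "c * F (reach F c A n) x \<le> c * F ?p x" for n
    by (intro mult_left_mono mono reach_le_limit c)
  then have "reach F c A (Suc n) x \<le> c * F ?p x" for n
    using False by simp
  then have le: "?p x \<le> c * F ?p x"
    by (intro LIMSEQ_le_const2[OF LIMSEQ_Suc[OF reach_tendsto[OF c]]]) auto
  have ge: "c * F ?p x \<le> ?p x + e" if "0 < e" for e
  proof -
    have "\<forall>\<^sub>F n in sequentially. \<bar>reach F c A n y - ?p y\<bar> < e" for y
      using tendstoD[OF reach_tendsto[OF c] \<open>0 < e\<close>] by (simp add: dist_real_def)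
    then have "\<forall>\<^sub>F n in sequentially. \<forall>y. \<bar>reach F c A n y - ?p y\<bar> < e"
      by (simp add: eventually_all_finite)
    then obtain n where n: "\<And>y. \<bar>reach F c A n y - ?p y\<bar> < e"
      using eventually_happens'[OF sequentially_bot] by blast
    have "F ?p x \<le> F (\<lambda>y. reach F c A n y + e) x"
      using n by (intro mono) (simp add: abs_less_iff less_imp_le algebra_simps)
    then have "c * F ?p x \<le> c * (F (reach F c A n) x + e)"
      using c by (simp add: translation mult_left_mono)
    also have "\<dots> = reach F c A (Suc n) x + c * e"
      using False by (simp add: algebra_simps)
    also have "\<dots> \<le> ?p x + e"
      using reach_le_limit[OF c, of A "Suc n" x] mult_right_mono[OF c(2), of e] \<open>0 < e\<close>
      by linarith
    finally show ?thesis .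
  qed
  show ?thesis using False le field_le_epsilon[OF ge] by simp
qed

text \<open>
  Within \<open>n\<close> steps at most \<open>n\<close> discount factors are collected. This makes the discounted values
  converge to the undiscounted ones as \<open>c\<close> tends to 1.
\<close>

lemma discounted_reach:
  assumes "0 \<le> c" "c \<le> 1" shows "c ^ n * reach F 1 A n x \<le> reach F c A n x"
proof (induction n arbitrary: x)
  case (Suc n)
  show ?case
  proof (cases "x \<in> A")
    case True
    then show ?thesis using power_le_one[OF assms, of "Suc n"] by (simp add: reach_target)
  next
    case False
    have "F (\<lambda>y. c ^ n * reach F 1 A n y) x \<le> F (reach F c A n) x"
      by (intro mono Suc)
    then show ?thesis
      using False assms by (simp add: scaling mult.assoc mult_left_mono)
  qed
qed simp

end

section \<open>Optimal matrices\<close>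

text \<open>
  Probabilities are finite, so the optimisation is carried out over real values, free of infinities;
  on embedded real functions the transition operators agree with these means.
\<close>

definition row_mean :: "real^'x::finite^'x \<Rightarrow> ('x \<Rightarrow> real) \<Rightarrow> 'x \<Rightarrow> real" where
  "row_mean T f x = (\<Sum>y\<in>UNIV. T $ x $ y * f y)"

definition lower_mean :: "(real^'x::finite^'x) set \<Rightarrow> ('x \<Rightarrow> real) \<Rightarrow> 'x \<Rightarrow> real" where
  "lower_mean \<T> f x = (INF T\<in>\<T>. row_mean T f x)"

definition upper_mean :: "(real^'x::finite^'x) set \<Rightarrow> ('x \<Rightarrow> real) \<Rightarrow> 'x \<Rightarrow> real" where
  "upper_mean \<T> f x = (SUP T\<in>\<T>. row_mean T f x)"

lemma row_mean_minus: "row_mean T (\<lambda>y. - f y) x = - row_mean T f x"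
  by (simp add: row_mean_def sum_negf)

lemma row_mean_scale: "row_mean T (\<lambda>y. a * f y) x = a * row_mean T f x"
  by (simp add: row_mean_def sum_distrib_left algebra_simps)

lemma row_mean_shift:
  "transition_matrix T \<Longrightarrow> row_mean T (\<lambda>y. f y + e) x = row_mean T f x + e"
  by (simp add: row_mean_def transition_matrix_def distrib_left sum.distrib
      flip: sum_distrib_right)

lemma row_mean_mono:
  "transition_matrix T \<Longrightarrow> (\<And>y. f y \<le> g y) \<Longrightarrow> row_mean T f x \<le> row_mean T g x"
  by (auto simp: row_mean_def transition_matrix_def intro!: sum_mono mult_left_mono)

lemma trans_op_ereal: "trans_op T (\<lambda>y. ereal (f y)) x = ereal (row_mean T f x)"
  by (simp add: trans_op_def row_mean_def)

lemma mean_singleton [simp]: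
  "lower_mean {T} = row_mean T" "upper_mean {T} = row_mean T"
  by (simp_all add: fun_eq_iff lower_mean_def upper_mean_def)

text \<open>
  The hypotheses on \<open>\<T>\<close> are bundled as a locale because they also hold of singletons. Results about
  a single homogeneous chain are obtained by instantiating the locale with \<open>{T}\<close>.
\<close>

locale transition_set =
  fixes \<T> :: "(real^'x::finite^'x) set"
  assumes stochastic: "T \<in> \<T> \<Longrightarrow> transition_matrix T"
    and nonempty: "\<T> \<noteq> {}"
    and closed: "closed \<T>"
    and separate_rows: "separately_specified_rows \<T>"
begin

lemma compact: "compact \<T>"
proof -
  have "norm T \<le> (\<Sum>(x::'x)\<in>UNIV. \<Sum>(y::'x)\<in>UNIV. 1)" if T: "T \<in> \<T>" for T
  proof -
    have entry: "norm (T $ x $ y) \<le> 1" for x y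
    proof -
      have "T $ x $ y \<le> (\<Sum>y\<in>UNIV. T $ x $ y)"
        using stochastic[OF T] by (intro member_le_sum) (auto simp: transition_matrix_def)
      then show ?thesis using stochastic[OF T] by (auto simp: transition_matrix_def)
    qed
    have "norm T \<le> (\<Sum>x\<in>UNIV. norm (T $ x))"
      unfolding norm_vec_def by (intro L2_set_le_sum) simp
    also have "\<dots> \<le> (\<Sum>(x::'x)\<in>UNIV. \<Sum>(y::'x)\<in>UNIV. norm (T $ x $ y))"
      unfolding norm_vec_def[of "T $ x" for x] by (intro sum_mono L2_set_le_sum) simp
    also have "\<dots> \<le> (\<Sum>(x::'x)\<in>UNIV. \<Sum>(y::'x)\<in>UNIV. 1)"
      by (intro sum_mono entry)
    finally show ?thesis .
  qed
  then have "bounded \<T>" unfolding bounded_iff by blast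
  then show ?thesis using closed by (simp add: compact_eq_bounded_closed)
qed

text \<open>
  Each row has its own maximising matrix by compactness, and separately specified rows allow these
  rows to be assembled into one element of \<open>\<T>\<close>. This is what makes homogeneous chains competitive.
\<close>

lemma maximising_matrix:
  obtains T where "T \<in> \<T>" "\<And>x T'. T' \<in> \<T> \<Longrightarrow> row_mean T' f x \<le> row_mean T f x"
proof -
  have "\<exists>T\<in>\<T>. \<forall>T'\<in>\<T>. row_mean T' f x \<le> row_mean T f x" for x
    unfolding row_mean_def
    by (intro continuous_attains_sup compact nonempty continuous_intros)
  then have "\<forall>x. \<exists>T. T \<in> \<T> \<and> (\<forall>T'\<in>\<T>. row_mean T' f x \<le> row_mean T f x)"
    by blast
  from choice[OF this] obtain R where R: "\<And>x. R x \<in> \<T>"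
    "\<And>x T'. T' \<in> \<T> \<Longrightarrow> row_mean T' f x \<le> row_mean (R x) f x"
    by blast
  obtain T where T: "T \<in> \<T>" "\<And>x. T $ x = R x $ x"
    using separate_rows R(1) unfolding separately_specified_rows_def by blast
  show thesis
    using R(2) by (intro that[OF T(1)]) (simp add: row_mean_def T(2))
qed

lemma upper_meanI:
  assumes "T \<in> \<T>" "\<And>T'. T' \<in> \<T> \<Longrightarrow> row_mean T' f x \<le> row_mean T f x"
  shows "upper_mean \<T> f x = row_mean T f x"
  unfolding upper_mean_def by (rule cSup_eq_maximum) (use assms in auto)

lemma upper_mean_attained:
  obtains T where "T \<in> \<T>" "\<And>x. upper_mean \<T> f x = row_mean T f x"
proof -
  obtain T where T: "T \<in> \<T>" "\<And>x T'. T' \<in> \<T> \<Longrightarrow> row_mean T' f x \<le> row_mean T f x"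
    using maximising_matrix[of f] by blast
  show thesis
    by (rule that[OF T(1)], rule upper_meanI) (use T in auto)
qed

lemma row_mean_le_upper_mean:
  assumes "T \<in> \<T>" shows "row_mean T f x \<le> upper_mean \<T> f x"
proof -
  obtain T' where T': "T' \<in> \<T>" "\<And>x T. T \<in> \<T> \<Longrightarrow> row_mean T f x \<le> row_mean T' f x"
    using maximising_matrix[of f] by blast
  then show ?thesis
    using upper_meanI[of T' f x] assms by simp
qed

lemma lower_mean_eq: "lower_mean \<T> f x = - upper_mean \<T> (\<lambda>y. - f y) x"
  unfolding lower_mean_def upper_mean_def Inf_real_def image_image row_mean_minus ..

lemma lower_mean_attained:
  obtains T where "T \<in> \<T>" "\<And>x. lower_mean \<T> f x = row_mean T f x"
proof -
  obtain T where T: "T \<in> \<T>" "\<And>x. upper_mean \<T> (\<lambda>y. - f y) x = row_mean T (\<lambda>y. - f y) x"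
    using upper_mean_attained[of "\<lambda>y. - f y"] by blast
  show thesis
    by (rule that[OF T(1)]) (simp add: lower_mean_eq T(2) row_mean_minus)
qed

lemma lower_mean_le_row_mean: "T \<in> \<T> \<Longrightarrow> lower_mean \<T> f x \<le> row_mean T f x"
  using row_mean_le_upper_mean[of T "\<lambda>y. - f y" x] by (simp add: lower_mean_eq row_mean_minus)

sublocale upper: average_operator "upper_mean \<T>"
proof
  fix f g :: "'x \<Rightarrow> real" and x assume fg: "\<And>y. f y \<le> g y"
  obtain T where T: "T \<in> \<T>" "\<And>x. upper_mean \<T> f x = row_mean T f x"
    using upper_mean_attained[of f] by blast
  have "row_mean T f x \<le> row_mean T g x"
    by (rule row_mean_mono[OF stochastic[OF T(1)] fg])
  also have "\<dots> \<le> upper_mean \<T> g x"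
    by (rule row_mean_le_upper_mean[OF T(1)])
  finally show "upper_mean \<T> f x \<le> upper_mean \<T> g x" by (simp add: T(2))
next
  fix f :: "'x \<Rightarrow> real" and e x
  obtain T where T: "T \<in> \<T>" "\<And>x T'. T' \<in> \<T> \<Longrightarrow> row_mean T' f x \<le> row_mean T f x"
    using maximising_matrix[of f] by blast
  have "upper_mean \<T> (\<lambda>y. f y + e) x = row_mean T (\<lambda>y. f y + e) x"
    by (rule upper_meanI) (use T in \<open>auto simp: row_mean_shift stochastic\<close>)
  also have "\<dots> = upper_mean \<T> f x + e"
    using upper_meanI[OF T] by (simp add: row_mean_shift stochastic T(1))
  finally show "upper_mean \<T> (\<lambda>y. f y + e) x = upper_mean \<T> f x + e" .
next
  fix f :: "'x \<Rightarrow> real" and a :: real and x assume "0 \<le> a"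
  obtain T where T: "T \<in> \<T>" "\<And>x T'. T' \<in> \<T> \<Longrightarrow> row_mean T' f x \<le> row_mean T f x"
    using maximising_matrix[of f] by blast
  have "upper_mean \<T> (\<lambda>y. a * f y) x = row_mean T (\<lambda>y. a * f y) x"
    by (rule upper_meanI) (use T \<open>0 \<le> a\<close> in \<open>auto simp: row_mean_scale mult_left_mono\<close>)
  also have "\<dots> = a * upper_mean \<T> f x"
    using upper_meanI[OF T] by (simp add: row_mean_scale)
  finally show "upper_mean \<T> (\<lambda>y. a * f y) x = a * upper_mean \<T> f x" .
qed

sublocale lower: average_operator "lower_mean \<T>"
proof
  fix f g :: "'x \<Rightarrow> real" and x assume "\<And>y. f y \<le> g y"
  then show "lower_mean \<T> f x \<le> lower_mean \<T> g x"
    by (simp add: lower_mean_eq upper.mono)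
next
  fix f :: "'x \<Rightarrow> real" and e x
  show "lower_mean \<T> (\<lambda>y. f y + e) x = lower_mean \<T> f x + e"
    using upper.translation[of "\<lambda>y. - f y" "- e" x] by (simp add: lower_mean_eq)
next
  fix f :: "'x \<Rightarrow> real" and a :: real and x assume "0 \<le> a"
  then show "lower_mean \<T> (\<lambda>y. a * f y) x = a * lower_mean \<T> f x"
    using upper.scaling[of a "\<lambda>y. - f y" x] by (simp add: lower_mean_eq)
qed

lemma upper_trans_ereal: "upper_trans \<T> (\<lambda>y. ereal (f y)) x = ereal (upper_mean \<T> f x)"
proof -
  obtain T where T: "T \<in> \<T>" "\<And>x. upper_mean \<T> f x = row_mean T f x"
    using upper_mean_attained[of f] by blast
  show ?thesis
    unfolding upper_trans_def trans_op_ereal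
  proof (rule antisym)
    show "(SUP T\<in>\<T>. ereal (row_mean T f x)) \<le> ereal (upper_mean \<T> f x)"
      by (intro SUP_least) (simp add: row_mean_le_upper_mean)
    show "ereal (upper_mean \<T> f x) \<le> (SUP T\<in>\<T>. ereal (row_mean T f x))"
      unfolding T(2) by (intro SUP_upper T(1))
  qed
qed

lemma lower_trans_ereal: "lower_trans \<T> (\<lambda>y. ereal (f y)) x = ereal (lower_mean \<T> f x)"
proof -
  obtain T where T: "T \<in> \<T>" "\<And>x. lower_mean \<T> f x = row_mean T f x"
    using lower_mean_attained[of f] by blast
  show ?thesis
    unfolding lower_trans_def trans_op_ereal
  proof (rule antisym)
    show "ereal (lower_mean \<T> f x) \<le> (INF T\<in>\<T>. ereal (row_mean T f x))"
      by (intro INF_greatest) (simp add: lower_mean_le_row_mean)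
    show "(INF T\<in>\<T>. ereal (row_mean T f x)) \<le> ereal (lower_mean \<T> f x)"
      unfolding T(2) by (intro INF_lower T(1))
  qed
qed

end

lemma transition_set_singleton: "transition_matrix T \<Longrightarrow> transition_set {T}"
  by unfold_locales (auto simp: separately_specified_rows_def)


section \<open>Supermartingales dominate expectations\<close>

lemma space_path_measure: "space (path_measure (P :: 'x::finite process)) = UNIV"
  using sets_eq_imp_space_eq[OF sets_path_measure, of P] by (simp add: space_PiM)

lemma prob_space_path_measure: "prob_space (path_measure (P :: 'x::finite process))"
  using emeasure_cylinder[of P "[]"]
  by (intro prob_spaceI) (simp add: space_path_measure path_prefix_def)

lemma length_path_prefix [simp]: "length (path_prefix n \<omega>) = n"
  by (simp add: path_prefix_def)

lemma set_path_prefix: "set (path_prefix n \<omega>) = \<omega> ` {..<n}"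
  by (auto simp: path_prefix_def)

lemma path_prefix_eq_iff:
  "length s = n \<Longrightarrow> path_prefix n \<omega> = s \<longleftrightarrow> (\<forall>i\<in>{..<n}. \<omega> i = s ! i)"
  by (auto simp: path_prefix_def list_eq_iff_nth_eq)

lemma path_prefix_1: "path_prefix (Suc 0) \<omega> = [\<omega> 0]"
  by (simp add: path_prefix_def)

lemma sets_cylinder:
  assumes "length s = n"
  shows "{\<omega>. path_prefix n \<omega> = s} \<in> sets (path_measure (P :: 'x::finite process))"
proof -
  have "Measurable.pred (PiM UNIV (\<lambda>_. count_space (UNIV :: 'x set))) (\<lambda>\<omega>. \<forall>i\<in>{..<n}. \<omega> i = s ! i)"
    by measurable
  then show ?thesis
    by (simp add: pred_def sets_path_measure space_PiM path_prefix_eq_iff[OF assms])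
qed

lemma finite_words: "finite {s :: 'x::finite list. length s = n}"
  using finite_lists_length_eq[of "UNIV :: 'x set" n] by simp

lemma path_prefix_eq_sum:
  fixes g :: "'x::finite list \<Rightarrow> ennreal"
  shows "g (path_prefix n \<omega>) = (\<Sum>s | length s = n. g s * indicator {\<omega>. path_prefix n \<omega> = s} \<omega>)"
proof -
  have "(\<Sum>s | length s = n. g s * indicator {\<omega>. path_prefix n \<omega> = s} \<omega>) =
      (\<Sum>s | length s = n. if s = path_prefix n \<omega> then g s else 0)"
    by (intro sum.cong) (auto simp: indicator_def)
  then show ?thesis by (simp add: sum.delta finite_words)
qed

lemma measurable_cylinder_term:
  fixes a :: ennreal
  assumes "length s = n"
  shows "(\<lambda>\<omega>. a * indicator {\<omega>. path_prefix n \<omega> = s} \<omega>)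
    \<in> borel_measurable (path_measure (P :: 'x::finite process))"
  using sets_cylinder[OF assms, of P] by measurable

text \<open>
  A function of finitely many coordinates integrates to a finite sum over words, weighted with the
  cylinder probabilities. It reduces conditional expectations to the product form of these weights.
\<close>

lemma nn_integral_path_prefix:
  fixes P :: "'x::finite process" and g :: "'x list \<Rightarrow> ennreal"
  shows "(\<integral>\<^sup>+\<omega>. g (path_prefix n \<omega>) \<partial>path_measure P) =
    (\<Sum>s | length s = n. g s * ennreal (\<Prod>i<n. pmf (P (take i s)) (s ! i)))"
proof -
  let ?C = "\<lambda>s. {\<omega> :: nat \<Rightarrow> 'x. path_prefix n \<omega> = s}"
  have "(\<integral>\<^sup>+\<omega>. g (path_prefix n \<omega>) \<partial>path_measure P) =
      (\<Sum>s | length s = n. \<integral>\<^sup>+\<omega>. g s * indicator (?C s) \<omega> \<partial>path_measure P)"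
    unfolding path_prefix_eq_sum[of g n] by (rule nn_integral_sum) (simp add: measurable_cylinder_term)
  also have "\<dots> = (\<Sum>s | length s = n. g s * emeasure (path_measure P) (?C s))"
    by (intro sum.cong refl nn_integral_cmult_indicator) (simp add: sets_cylinder)
  also have "\<dots> = (\<Sum>s | length s = n. g s * ennreal (\<Prod>i<n. pmf (P (take i s)) (s ! i)))"
    by (intro sum.cong refl) (use emeasure_cylinder[of P] in auto)
  finally show ?thesis .
qed

lemma sum_words_Suc:
  fixes h :: "'x::finite list \<Rightarrow> 'b::comm_monoid_add"
  shows "(\<Sum>s | length s = Suc n. h s) = (\<Sum>s | length s = n. \<Sum>y\<in>UNIV. h (s @ [y]))"
proof -
  have "{s :: 'x list. length s = Suc n} = (\<lambda>(s, y). s @ [y]) ` ({s. length s = n} \<times> UNIV)"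
  proof (intro equalityI subsetI)
    fix s :: "'x list" assume "s \<in> {s. length s = Suc n}"
    then show "s \<in> (\<lambda>(s, y). s @ [y]) ` ({s. length s = n} \<times> UNIV)"
      by (cases s rule: rev_cases) force+
  qed auto
  moreover have "inj_on (\<lambda>(s, y). s @ [y]) ({s :: 'x list. length s = n} \<times> UNIV)"
    by (auto simp: inj_on_def)
  ultimately show ?thesis
    by (simp only: sum.reindex sum.cartesian_product) (simp add: case_prod_beta)
qed

text \<open>
  The tower property for one step: the weight of \<open>s @ [y]\<close> is that of \<open>s\<close> times the transition
  probability from \<open>s\<close> to \<open>y\<close>.
\<close>

lemma nn_integral_path_prefix_Suc:
  fixes P :: "'x::finite process" and N :: "'x list \<Rightarrow> ennreal"
  shows "(\<integral>\<^sup>+\<omega>. N (path_prefix (Suc n) \<omega>) \<partial>path_measure P) =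
    (\<integral>\<^sup>+\<omega>. (\<Sum>y\<in>UNIV. ennreal (pmf (P (path_prefix n \<omega>)) y) * N (path_prefix n \<omega> @ [y]))
      \<partial>path_measure P)"
proof -
  let ?W = "\<lambda>s. \<Prod>i<length s. pmf (P (take i s)) (s ! i)"
  have W: "?W (s @ [y]) = ?W s * pmf (P s) y" for s y
    by (simp add: nth_append)
  have "(\<integral>\<^sup>+\<omega>. N (path_prefix (Suc n) \<omega>) \<partial>path_measure P) =
      (\<Sum>s | length s = Suc n. N s * ennreal (?W s))"
    unfolding nn_integral_path_prefix by (intro sum.cong) auto
  also have "\<dots> = (\<Sum>s | length s = n. (\<Sum>y\<in>UNIV. ennreal (pmf (P s) y) * N (s @ [y])) * ennreal (?W s))"
    unfolding sum_words_Suc W sum_distrib_right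
    by (intro sum.cong refl) (simp add: ennreal_mult prod_nonneg mult_ac)
  also have "\<dots> = (\<Sum>s | length s = n. (\<Sum>y\<in>UNIV. ennreal (pmf (P s) y) * N (s @ [y])) *
      ennreal (\<Prod>i<n. pmf (P (take i s)) (s ! i)))"
    by (intro sum.cong) auto
  finally show ?thesis
    unfolding nn_integral_path_prefix[where g = "\<lambda>s. \<Sum>y\<in>UNIV. ennreal (pmf (P s) y) * N (s @ [y])"] .
qed

lemma AE_condition_start:
  "AE \<omega> in path_measure (condition P [x :: 'x::finite]). \<omega> 0 = x"
proof -
  interpret prob_space "path_measure (condition P [x])" by (rule prob_space_path_measure)
  have "prob {\<omega>. path_prefix (Suc 0) \<omega> = [x]} = 1"
    using emeasure_cylinder[of "condition P [x]" "[x]"]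
    by (simp add: condition_def measure_def)
  then have "AE \<omega> in path_measure (condition P [x]). \<omega> \<in> {\<omega>. path_prefix (Suc 0) \<omega> = [x]}"
    by (subst prob_eq_1[symmetric]) (simp_all add: sets_cylinder)
  then show ?thesis by (simp add: path_prefix_1)
qed

text \<open>
  Expected values of a non-negative supermartingale decrease in time. They start at \<open>N [x]\<close> because
  the conditioned process starts in \<open>x\<close> almost surely.
\<close>

lemma nn_integral_supermartingale_le:
  fixes P :: "'x::finite process" and N :: "'x list \<Rightarrow> ennreal"
  assumes N: "\<And>s. s \<noteq> [] \<Longrightarrow> (\<Sum>y\<in>UNIV. ennreal (pmf (P s) y) * N (s @ [y])) \<le> N s"
  shows "(\<integral>\<^sup>+\<omega>. N (path_prefix (Suc m) \<omega>) \<partial>path_measure (condition P [x])) \<le> N [x]"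
proof (induction m)
  case 0
  interpret prob_space "path_measure (condition P [x])" by (rule prob_space_path_measure)
  have "(\<integral>\<^sup>+\<omega>. N (path_prefix (Suc 0) \<omega>) \<partial>path_measure (condition P [x])) =
      (\<integral>\<^sup>+\<omega>. N [x] \<partial>path_measure (condition P [x]))"
    using AE_condition_start[where P = P and x = x] by (intro nn_integral_cong_AE) (auto simp: path_prefix_1)
  then show ?case by (simp add: emeasure_space_1)
next
  case (Suc m)
  have "condition P [x] s = P s" if "s \<noteq> []" for s
    using that by (cases s) (auto simp: condition_def)
  moreover have "path_prefix (Suc m) \<omega> \<noteq> []" for \<omega> :: "nat \<Rightarrow> 'x"
    by (metis length_path_prefix length_0_conv nat.distinct(1))
  ultimately have "(\<integral>\<^sup>+\<omega>. N (path_prefix (Suc (Suc m)) \<omega>) \<partial>path_measure (condition P [x])) \<le>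
      (\<integral>\<^sup>+\<omega>. N (path_prefix (Suc m) \<omega>) \<partial>path_measure (condition P [x]))"
    unfolding nn_integral_path_prefix_Suc[where n = "Suc m"]
    by (intro nn_integral_mono) (simp add: N)
  then show ?case using Suc by (rule order_trans)
qed

text \<open>
  The link between the measure-theoretic and the game-theoretic side. Both \<open>f\<close> and \<open>M\<close> are bounded
  below, so a constant shift makes them non-negative; Fatou's lemma exchanges the limit
  inferior with the expectation, and the expectations are bounded by the initial value.
\<close>

lemma cond_expectation_le_supermartingale:
  fixes f :: "(nat \<Rightarrow> 'x::finite) \<Rightarrow> real"
  assumes P: "P \<in> processes_I \<T>" and M: "supermartingale Q \<T> M"
    and f: "f \<in> borel_measurable (path_measure (condition P [x]))" and B: "\<And>\<omega>. \<bar>f \<omega>\<bar> \<le> B"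
    and dom: "\<And>\<omega>. \<omega> 0 = x \<Longrightarrow> ereal (f \<omega>) \<le> liminf (\<lambda>m. M (path_prefix (Suc m) \<omega>))"
  shows "ereal (cond_expectation P f [x]) \<le> M [x]"
proof -
  obtain b where b: "\<And>s. ereal b \<le> M s"
    and step: "\<And>s. local_upper Q \<T> s (\<lambda>y. M (s @ [y])) \<le> M s"
    using M unfolding supermartingale_def by blast
  \<comment> \<open>large enough to make both \<open>M + c\<close> and \<open>f + c\<close> non-negative\<close>
  define c where "c = \<bar>b\<bar> + \<bar>B\<bar>"
  have c: "0 \<le> c" "0 \<le> f \<omega> + c" for \<omega>
    using B[of \<omega>] by (auto simp: c_def)
  have Mc: "0 \<le> M s + ereal c" for s
  proof -
    have "ereal 0 \<le> ereal b + ereal c" by (simp add: c_def)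
    also have "\<dots> \<le> M s + ereal c" by (intro add_right_mono b)
    finally show ?thesis by (simp add: zero_ereal_def)
  qed
  define N where "N s = e2ennreal (M s + ereal c)" for s
  have N: "enn2ereal (N s) = M s + ereal c" for s
    unfolding N_def by (rule enn2ereal_e2ennreal[OF Mc])
  have Nstep: "(\<Sum>y\<in>UNIV. ennreal (pmf (P s) y) * N (s @ [y])) \<le> N s" if s: "s \<noteq> []" for s
  proof -
    obtain T where T: "T \<in> \<T>" "\<And>y. pmf (P s) y = T $ last s $ y"
      using P s unfolding processes_I_def by blast
    have MN: "M (s @ [y]) \<noteq> - \<infinity>" for y
      using b[of "s @ [y]"] by auto
    have "enn2ereal (\<Sum>y\<in>UNIV. ennreal (pmf (P s) y) * N (s @ [y])) =
        (\<Sum>y\<in>UNIV. ereal (pmf (P s) y) * (M (s @ [y]) + ereal c))"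
      by (subst sum_enn2ereal[symmetric]) (simp_all add: times_ennreal.rep_eq N enn2ereal_ennreal)
    also have "\<dots> = (\<Sum>y\<in>UNIV. ereal (pmf (P s) y) * M (s @ [y]) + ereal (pmf (P s) y * c))"
      using MN by (intro sum.cong refl) (simp add: ereal_distrib_left)
    also have "\<dots> = trans_op T (\<lambda>y. M (s @ [y])) (last s) + ereal c"
      by (simp add: sum.distrib trans_op_def T(2)[symmetric] sum_pmf_eq_1 flip: sum_distrib_right)
    also have "trans_op T (\<lambda>y. M (s @ [y])) (last s) \<le> local_upper Q \<T> s (\<lambda>y. M (s @ [y]))"
      using s T(1) by (auto simp: local_upper_def upper_trans_def intro: SUP_upper)
    also have "\<dots> \<le> M s" by (rule step)
    finally show ?thesis
      unfolding less_eq_ennreal.rep_eq N by (simp add: add_right_mono)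
  qed
  let ?\<mu> = "path_measure (condition P [x])"
  interpret prob_space ?\<mu> by (rule prob_space_path_measure)
  have int: "integrable ?\<mu> f"
    using B by (intro integrable_const_bound[of _ B]) (auto simp: f)
  have N_meas: "(\<lambda>\<omega>. N (path_prefix n \<omega>)) \<in> borel_measurable ?\<mu>" for n
    unfolding path_prefix_eq_sum[of N n] by (intro borel_measurable_sum) (simp add: measurable_cylinder_term)
  have "ennreal (f \<omega> + c) \<le> liminf (\<lambda>m. N (path_prefix (Suc m) \<omega>))" if "\<omega> 0 = x" for \<omega>
  proof -
    have "ereal (f \<omega>) + ereal c \<le> liminf (\<lambda>m. M (path_prefix (Suc m) \<omega>)) + ereal c"
      by (intro add_right_mono dom that)
    also have "\<dots> = liminf (\<lambda>m. M (path_prefix (Suc m) \<omega>) + ereal c)"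
      by (simp add: Liminf_add_ereal_right)
    finally have "e2ennreal (ereal (f \<omega>) + ereal c) \<le>
        e2ennreal (liminf (\<lambda>m. M (path_prefix (Suc m) \<omega>) + ereal c))"
      by (rule e2ennreal_mono)
    also have "\<dots> = liminf (\<lambda>m. N (path_prefix (Suc m) \<omega>))"
      unfolding N_def
      by (rule Liminf_compose_continuous_mono[symmetric])
        (auto intro: continuous_on_e2ennreal monoI e2ennreal_mono)
    finally show ?thesis by simp
  qed
  then have "(\<integral>\<^sup>+\<omega>. ennreal (f \<omega> + c) \<partial>?\<mu>) \<le> (\<integral>\<^sup>+\<omega>. liminf (\<lambda>m. N (path_prefix (Suc m) \<omega>)) \<partial>?\<mu>)"
    using AE_condition_start[where P = P and x = x] by (intro nn_integral_mono_AE) auto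
  also have "\<dots> \<le> liminf (\<lambda>m. \<integral>\<^sup>+\<omega>. N (path_prefix (Suc m) \<omega>) \<partial>?\<mu>)"
    by (intro nn_integral_liminf N_meas)
  also have "\<dots> \<le> liminf (\<lambda>m. N [x])"
    by (intro Liminf_mono always_eventually allI nn_integral_supermartingale_le Nstep)
  also have "\<dots> = N [x]" by (simp add: Liminf_const)
  also have "(\<integral>\<^sup>+\<omega>. ennreal (f \<omega> + c) \<partial>?\<mu>) = ennreal (cond_expectation P f [x] + c)"
    using int c by (subst nn_integral_eq_integral) (simp_all add: cond_expectation_def prob_space)
  finally have "ennreal (cond_expectation P f [x] + c) \<le> N [x]" .
  moreover have "0 \<le> cond_expectation P f [x] + c"
  proof -
    have "0 \<le> (\<integral>\<omega>. f \<omega> + c \<partial>?\<mu>)" using c by (intro Bochner_Integration.integral_nonneg) auto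
    then show ?thesis using int by (simp add: cond_expectation_def prob_space)
  qed
  ultimately have "ereal (cond_expectation P f [x] + c) \<le> M [x] + ereal c"
    unfolding less_eq_ennreal.rep_eq N by (simp add: enn2ereal_ennreal)
  then show ?thesis by (cases "M [x]") auto
qed

lemma cond_expectation_le_upper_expectation_V:
  fixes f :: "(nat \<Rightarrow> 'x::finite) \<Rightarrow> real"
  assumes "P \<in> processes_I \<T>"
    and "f \<in> borel_measurable (path_measure (condition P [x]))" and "\<And>\<omega>. \<bar>f \<omega>\<bar> \<le> B"
  shows "ereal (cond_expectation P f [x]) \<le> upper_expectation_V Q \<T> (\<lambda>\<omega>. ereal (f \<omega>)) [x]"
  unfolding upper_expectation_V_def
  using assms
  by (auto intro!: Inf_greatest cond_expectation_le_supermartingale simp: path_prefix_1)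


section \<open>Supermartingales for the hitting event\<close>

definition visits :: "'x set \<Rightarrow> 'x list \<Rightarrow> bool" where
  "visits A s \<longleftrightarrow> set s \<inter> A \<noteq> {}"

lemma visits_singleton [simp]: "visits A [x] \<longleftrightarrow> x \<in> A"
  by (simp add: visits_def)

lemma visits_snoc [simp]: "visits A (s @ [y]) \<longleftrightarrow> visits A s \<or> y \<in> A"
  by (auto simp: visits_def)

lemma not_visits_last: "s \<noteq> [] \<Longrightarrow> \<not> visits A s \<Longrightarrow> last s \<notin> A"
  unfolding visits_def using last_in_set by blast

lemma hitting_indicator_path_prefix:
  "hitting_indicator A \<omega> = (if \<exists>m. visits A (path_prefix (Suc m) \<omega>) then 1 else 0)"
  unfolding hitting_indicator_def visits_def set_path_prefix by auto

lemma eventually_visits: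
  assumes "hitting_indicator A \<omega> = 1"
  shows "\<forall>\<^sub>F m in sequentially. visits A (path_prefix (Suc m) \<omega>)"
proof -
  obtain t where "\<omega> t \<in> A"
    using assms by (auto simp: hitting_indicator_def split: if_splits)
  then show ?thesis
    unfolding eventually_sequentially visits_def set_path_prefix
    by (intro exI[of _ t]) (fastforce simp: less_Suc_eq_le)
qed

context transition_set
begin

text \<open>
  Real processes that satisfy the supermartingale inequality at situations suffice: the value
  \<open>\<infinity>\<close> at the empty string makes the inequality there trivial.
\<close>

lemma upper_expectation_V_le:
  assumes bound: "\<And>s. b \<le> m s"
    and step: "\<And>s. s \<noteq> [] \<Longrightarrow> upper_mean \<T> (\<lambda>y. m (s @ [y])) (last s) \<le> m s"
    and dom: "\<And>\<omega>. \<forall>\<^sub>F k in sequentially. f \<omega> \<le> m (path_prefix (Suc k) \<omega>)"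
  shows "upper_expectation_V Q \<T> (\<lambda>\<omega>. ereal (f \<omega>)) [x] \<le> ereal (m [x])"
proof -
  let ?M = "\<lambda>s. if s = [] then \<infinity> else ereal (m s)"
  have "supermartingale Q \<T> ?M"
    unfolding supermartingale_def local_upper_def
    using bound step by (auto simp: upper_trans_ereal)
  moreover have "ereal (f \<omega>) \<le> liminf (\<lambda>k. ?M (path_prefix (Suc k) \<omega>))" for \<omega>
  proof -
    have "path_prefix (Suc k) \<omega> \<noteq> []" for k
      by (simp add: path_prefix_def)
    then show ?thesis
      using dom[of \<omega>] by (intro Liminf_bounded) simp
  qed
  ultimately have "upper_expectation_V Q \<T> (\<lambda>\<omega>. ereal (f \<omega>)) [x] \<le> ?M [x]"
    unfolding upper_expectation_V_def by (intro Inf_lower CollectI exI[of _ ?M]) simp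
  then show ?thesis by simp
qed

text \<open>
  The supermartingale is \<open>g\<close> at the current state, frozen at 1 once \<open>A\<close> has been visited. Freezing can
  only lower the value, since \<open>g \<ge> 1\<close> on \<open>A\<close>.
\<close>

lemma upper_V_hitting_le_supersolution:
  assumes g0: "\<And>x. 0 \<le> g x"
    and g: "\<And>x. (if x \<in> A then 1 else upper_mean \<T> g x) \<le> g x"
  shows "upper_expectation_V Q \<T> (\<lambda>\<omega>. ereal (hitting_indicator A \<omega>)) [x] \<le> ereal (g x)"
proof -
  let ?m = "\<lambda>s. if visits A s then 1 else g (last s)"
  have "upper_expectation_V Q \<T> (\<lambda>\<omega>. ereal (hitting_indicator A \<omega>)) [x] \<le> ereal (?m [x])"
  proof (rule upper_expectation_V_le)
    show "0 \<le> ?m s" for s by (simp add: g0)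
    show "upper_mean \<T> (\<lambda>y. ?m (s @ [y])) (last s) \<le> ?m s" if s: "s \<noteq> []" for s
    proof (cases "visits A s")
      case True
      then show ?thesis by (simp add: upper.const)
    next
      case False
      have "?m (s @ [y]) \<le> g y" for y
        using False g[of y] by auto
      then have "upper_mean \<T> (\<lambda>y. ?m (s @ [y])) (last s) \<le> upper_mean \<T> g (last s)"
        by (rule upper.mono)
      also have "\<dots> \<le> g (last s)"
        using g[of "last s"] not_visits_last[OF s False] by simp
      finally show ?thesis using False by simp
    qed
    show "\<forall>\<^sub>F k in sequentially. hitting_indicator A \<omega> \<le> ?m (path_prefix (Suc k) \<omega>)" for \<omega>
    proof (cases "hitting_indicator A \<omega> = 1")
      case True
      show ?thesis
        using eventually_visits[OF True] by eventually_elim (simp add: True)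
    next
      case False
      then show ?thesis
        by (auto simp: hitting_indicator_def g0 split: if_splits)
    qed
  qed
  also have "\<dots> \<le> ereal (g x)" using g[of x] by auto
  finally show ?thesis .
qed

text \<open>
  The negative of the \<open>n\<close>-step value with the remaining horizon. It is eventually 0 on paths
  that avoid \<open>A\<close>, because the horizon runs out, and this is what the infinite-horizon value would
  not guarantee.
\<close>

lemma reach_le_lower_V_hitting:
  "ereal (reach (lower_mean \<T>) 1 A n x) \<le>
    lower_expectation_V Q \<T> (\<lambda>\<omega>. ereal (hitting_indicator A \<omega>)) [x]"
proof -
  let ?h = "reach (lower_mean \<T>) 1 A"
  \<comment> \<open>\<open>[x]\<close> has length 1 and must keep the full horizon \<open>n\<close>; truncated subtraction gives horizon 0,
    that is, value 0, at unsuccessful situations after time \<open>n\<close>\<close>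
  let ?v = "\<lambda>s. if visits A s then 1 else ?h (Suc n - length s) (last s)"
  have v1: "?v s \<le> 1" and v0: "0 \<le> ?v s" for s
    by (simp_all add: lower.reach_le_1 lower.reach_nonneg)
  have "upper_expectation_V Q \<T> (\<lambda>\<omega>. ereal (- hitting_indicator A \<omega>)) [x] \<le> ereal (- ?v [x])"
  proof (rule upper_expectation_V_le)
    show "- 1 \<le> - ?v s" for s using v1[of s] by linarith
    show "upper_mean \<T> (\<lambda>y. - ?v (s @ [y])) (last s) \<le> - ?v s" if s: "s \<noteq> []" for s
    proof -
      have "?v s \<le> lower_mean \<T> (\<lambda>y. ?v (s @ [y])) (last s)"
      proof (cases "visits A s")
        case True
        then show ?thesis by (simp add: lower.const)
      next
        case False
        note last = not_visits_last[OF s False]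
        have v: "?v (s @ [y]) = ?h (n - length s) y" if "length s \<le> n" for y
          using False that by (auto simp: reach_target)
        show ?thesis
        proof (cases "length s \<le> n")
          case True
          then have "?v s = lower_mean \<T> (?h (n - length s)) (last s)"
            using False last by (simp add: Suc_diff_le)
          then show ?thesis by (simp only: v[OF True] order_refl)
        next
          case late: False
          then have "?v s = 0" using False last by simp
          also have "0 = lower_mean \<T> (\<lambda>_. 0) (last s)" by (simp add: lower.const)
          also have "\<dots> \<le> lower_mean \<T> (\<lambda>y. ?v (s @ [y])) (last s)"
            by (intro lower.mono v0)
          finally show ?thesis .
        qed
      qed
      then show ?thesis by (simp add: lower_mean_eq)
    qed
    show "\<forall>\<^sub>F k in sequentially. - hitting_indicator A \<omega> \<le> - ?v (path_prefix (Suc k) \<omega>)" for \<omega>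
    proof (cases "hitting_indicator A \<omega> = 1")
      case True
      have "- hitting_indicator A \<omega> \<le> - ?v s" for s
        using v1[of s] True by linarith
      then show ?thesis by (intro always_eventually allI)
    next
      case False
      then have never: "\<not> visits A (path_prefix (Suc k) \<omega>)" and "hitting_indicator A \<omega> = 0" for k
        by (auto simp: hitting_indicator_path_prefix split: if_splits)
      moreover have "?v (path_prefix (Suc k) \<omega>) = 0" if "n \<le> k" for k
        using never[of k] that not_visits_last[OF _ never[of k]]
        by (auto simp: path_prefix_def)
      ultimately show ?thesis
        unfolding eventually_sequentially by (intro exI[of _ n]) simp
    qed
  qed
  also have "?v [x] = ?h n x" by (simp add: reach_target)
  finally show ?thesis
    unfolding lower_expectation_V_def using ereal_minus_le_minus by fastforce
qed

end

section \<open>Attainment by homogeneous chains\<close>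

lemma ex_homogeneous_chain:
  fixes T :: "real^'x::finite^'x"
  assumes "transition_matrix T"
  obtains P where "homogeneous_chain T P"
proof
  have "pmf (embed_pmf (\<lambda>y. T $ x $ y)) y = T $ x $ y" for x y
  proof (rule pmf_embed_pmf)
    show "0 \<le> T $ x $ y" for y using assms by (simp add: transition_matrix_def)
    show "(\<integral>\<^sup>+y. ennreal (T $ x $ y) \<partial>count_space UNIV) = 1"
      using assms by (simp add: transition_matrix_def nn_integral_count_space_finite)
  qed
  then show "homogeneous_chain T (\<lambda>s. embed_pmf (\<lambda>y. T $ last s $ y))"
    by (simp add: homogeneous_chain_def)
qed

lemma processes_H_subset_I: "processes_H \<T> \<subseteq> processes_I \<T>"
  by (auto simp: processes_H_def processes_I_def homogeneous_chain_def)

lemma hitting_expectation_le_upper_V: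
  assumes "P \<in> processes_I \<T>"
  shows "ereal (cond_expectation P (hitting_indicator A) [x]) \<le>
    upper_expectation_V Q \<T> (\<lambda>\<omega>. ereal (hitting_indicator A \<omega>)) [x]"
  by (rule cond_expectation_le_upper_expectation_V[OF assms measurable_hitting_indicator, where B = 1])
    (simp add: hitting_indicator_def)

lemma lower_V_le_hitting_expectation:
  assumes "P \<in> processes_I \<T>"
  shows "lower_expectation_V Q \<T> (\<lambda>\<omega>. ereal (hitting_indicator A \<omega>)) [x] \<le>
    ereal (cond_expectation P (hitting_indicator A) [x])"
proof -
  have "ereal (cond_expectation P (\<lambda>\<omega>. - hitting_indicator A \<omega>) [x]) \<le>
      upper_expectation_V Q \<T> (\<lambda>\<omega>. ereal (- hitting_indicator A \<omega>)) [x]"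
    by (rule cond_expectation_le_upper_expectation_V[OF assms, where B = 1])
      (intro borel_measurable_uminus measurable_hitting_indicator, simp add: hitting_indicator_def)
  then show ?thesis
    unfolding lower_expectation_V_def cond_expectation_def
    using ereal_minus_le_minus by fastforce
qed

context transition_set
begin

text \<open>
  For a matrix \<open>T\<close> minimising the rows against the limit \<open>p\<close>, \<open>p\<close> is a supersolution of the hitting
  equation of \<open>T\<close>, so it dominates the hitting probability of the chain.
\<close>

lemma lower_chain_attained:
  obtains P where "P \<in> processes_H \<T>"
    "\<And>x. cond_expectation P (hitting_indicator A) [x] \<le> reach_limit (lower_mean \<T>) 1 A x"
proof -
  let ?p = "reach_limit (lower_mean \<T>) 1 A"
  obtain T where T: "T \<in> \<T>" "\<And>x. lower_mean \<T> ?p x = row_mean T ?p x"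
    using lower_mean_attained[of ?p] by blast
  obtain P where P: "homogeneous_chain T P"
    using ex_homogeneous_chain[OF stochastic[OF T(1)]] by blast
  interpret T: transition_set "{T}"
    by (rule transition_set_singleton[OF stochastic[OF T(1)]])
  have "P \<in> processes_I {T}"
    using P processes_H_subset_I by (auto simp: processes_H_def)
  then have "ereal (cond_expectation P (hitting_indicator A) [x]) \<le> ereal (?p x)" for x
  proof (rule order_trans[OF hitting_expectation_le_upper_V T.upper_V_hitting_le_supersolution])
    show "0 \<le> ?p x" for x by (rule lower.reach_limit_nonneg) auto
    show "(if x \<in> A then 1 else upper_mean {T} ?p x) \<le> ?p x" for x
      using lower.reach_limit_fixed_point[of 1 A x] by (auto simp: T(2))
  qed
  then show thesis
    using P T(1) by (intro that[of P]) (auto simp: processes_H_def)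
qed

text \<open>
  Let \<open>T\<close> be maximising against the discounted value \<open>u\<close>. Unfolding \<open>u = c T u\<close> for \<open>n\<close> steps
  leaves a remainder of at most \<open>c ^ n\<close>, since \<open>u \<le> 1\<close>, and the rest is at most the probability of
  hitting within \<open>n\<close> steps. Without discounting the remainder need not vanish.
\<close>

lemma discounted_chain_attained:
  assumes c: "0 \<le> c" "c < 1"
  obtains P where "P \<in> processes_H \<T>"
    "\<And>x. reach_limit (upper_mean \<T>) c A x \<le> cond_expectation P (hitting_indicator A) [x]"
proof -
  let ?u = "reach_limit (upper_mean \<T>) c A"
  obtain T where T: "T \<in> \<T>" "\<And>x. upper_mean \<T> ?u x = row_mean T ?u x"
    using upper_mean_attained[of ?u] by blast
  obtain P where P: "homogeneous_chain T P"
    using ex_homogeneous_chain[OF stochastic[OF T(1)]] by blast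
  interpret T: transition_set "{T}"
    by (rule transition_set_singleton[OF stochastic[OF T(1)]])
  let ?h = "reach (lower_mean {T}) 1 A"
  have u: "?u x \<le> ?h n x + c ^ n" for n x
  proof (induction n arbitrary: x)
    case 0
    show ?case using upper.reach_limit_le_1[of c A x] c by (simp add: indicator_def)
  next
    case (Suc n)
    show ?case
    proof (cases "x \<in> A")
      case True
      then show ?thesis using upper.reach_limit_le_1[of c A x] c by (simp add: add_increasing2)
    next
      case False
      have h0: "0 \<le> row_mean T (?h n) x"
        using T.lower.reach_nonneg[of 1 A "Suc n" x] False by simp
      have "row_mean T ?u x \<le> row_mean T (\<lambda>y. ?h n y + c ^ n) x"
        by (intro row_mean_mono stochastic T(1) Suc)
      then have "c * row_mean T ?u x \<le> c * (row_mean T (?h n) x + c ^ n)"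
        using c by (intro mult_left_mono) (simp_all add: row_mean_shift stochastic T(1))
      also have "\<dots> \<le> row_mean T (?h n) x + c ^ Suc n"
        using mult_right_mono[of c 1, OF _ h0] c by (simp add: distrib_left)
      finally show ?thesis
        using False c upper.reach_limit_fixed_point[of c A x] by (simp add: T(2))
    qed
  qed
  have "P \<in> processes_I {T}"
    using P processes_H_subset_I by (auto simp: processes_H_def)
  then have h: "?h n x \<le> cond_expectation P (hitting_indicator A) [x]" for n x
    using T.reach_le_lower_V_hitting[of A n x "\<lambda>_. 0"]
      lower_V_le_hitting_expectation[of P "{T}" "\<lambda>_. 0" A x]
    by (metis ereal_less_eq(3) order_trans)
  have "?u x \<le> cond_expectation P (hitting_indicator A) [x]" for x
  proof (rule LIMSEQ_le_const)
    show "(\<lambda>n. cond_expectation P (hitting_indicator A) [x] + c ^ n) \<longlonglongrightarrow>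
        cond_expectation P (hitting_indicator A) [x]"
      using LIMSEQ_power_zero[of c] c by (intro tendsto_eq_intros) auto
    show "\<exists>N. \<forall>n\<ge>N. ?u x \<le> cond_expectation P (hitting_indicator A) [x] + c ^ n"
      using u[of x] h[of _ x] by (intro exI[of _ 0]) (meson add_right_mono order_trans)
  qed
  then show thesis
    using P T(1) by (intro that[of P]) (auto simp: processes_H_def)
qed

lemma reach_limit_le_SUP_processes_H:
  "ereal (reach_limit (upper_mean \<T>) 1 A x) \<le>
    (SUP P\<in>processes_H \<T>. ereal (cond_expectation P (hitting_indicator A) [x]))" (is "_ \<le> ?S")
proof -
  have "ereal (reach (upper_mean \<T>) 1 A n x) \<le> ?S" for n
  proof (rule tendsto_upperbound)
    show "((\<lambda>c. ereal (c ^ n * reach (upper_mean \<T>) 1 A n x)) \<longlongrightarrow>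
        ereal (reach (upper_mean \<T>) 1 A n x)) (at_left 1)"
      by (intro tendsto_eq_intros tendsto_ereal) auto
    have "ereal (c ^ n * reach (upper_mean \<T>) 1 A n x) \<le> ?S" if c: "0 < c" "c < 1" for c :: real
    proof -
      obtain P where P: "P \<in> processes_H \<T>"
        "\<And>x. reach_limit (upper_mean \<T>) c A x \<le> cond_expectation P (hitting_indicator A) [x]"
        using discounted_chain_attained[of c A] c by auto
      have "c ^ n * reach (upper_mean \<T>) 1 A n x \<le> reach (upper_mean \<T>) c A n x"
        using c by (intro upper.discounted_reach) auto
      also have "\<dots> \<le> reach_limit (upper_mean \<T>) c A x"
        using c by (intro upper.reach_le_limit) auto
      also have "\<dots> \<le> cond_expectation P (hitting_indicator A) [x]" by (rule P(2))
      finally show ?thesis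
        by (intro SUP_upper2[OF P(1)]) simp
    qed
    then show "\<forall>\<^sub>F c in at_left 1. ereal (c ^ n * reach (upper_mean \<T>) 1 A n x) \<le> ?S"
      by (auto simp: eventually_at_left[of 0 1] intro!: exI[of _ 0])
  qed (simp add: trivial_limit_at_left_real)
  moreover have "(\<lambda>n. ereal (reach (upper_mean \<T>) 1 A n x)) \<longlonglongrightarrow>
      ereal (reach_limit (upper_mean \<T>) 1 A x)"
    by (intro tendsto_ereal upper.reach_tendsto) auto
  ultimately show ?thesis
    by (intro LIMSEQ_le_const2[of _ _ ?S]) blast+
qed

section \<open>The hitting probabilities as minimal solutions\<close>

text \<open>
  The sandwich, started at the game-theoretic end and closed at the homogeneous end; all three types
  lie in between.
\<close>

lemma lower_hitting_prob_eq:
  "lower_hitting_prob \<tau> Q \<T> A x = ereal (reach_limit (lower_mean \<T>) 1 A x)"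
proof -
  let ?p = "ereal (reach_limit (lower_mean \<T>) 1 A x)"
  let ?V = "lower_expectation_V Q \<T> (\<lambda>\<omega>. ereal (hitting_indicator A \<omega>)) [x]"
  let ?I = "INF P\<in>processes_I \<T>. ereal (cond_expectation P (hitting_indicator A) [x])"
  let ?H = "INF P\<in>processes_H \<T>. ereal (cond_expectation P (hitting_indicator A) [x])"
  have "(\<lambda>n. ereal (reach (lower_mean \<T>) 1 A n x)) \<longlonglongrightarrow> ?p"
    by (intro tendsto_ereal lower.reach_tendsto) auto
  then have "?p \<le> ?V"
    by (rule LIMSEQ_le_const2) (use reach_le_lower_V_hitting in blast)
  moreover have "?V \<le> ?I"
    by (intro INF_greatest lower_V_le_hitting_expectation)
  moreover have "?I \<le> ?H"
    by (intro INF_superset_mono processes_H_subset_I order_refl)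
  moreover have "?H \<le> ?p"
  proof -
    obtain P where "P \<in> processes_H \<T>"
      "cond_expectation P (hitting_indicator A) [x] \<le> reach_limit (lower_mean \<T>) 1 A x"
      using lower_chain_attained[of A] by metis
    then show ?thesis by (intro INF_lower2[of P]) auto
  qed
  ultimately show ?thesis
    unfolding lower_hitting_prob_def by (cases \<tau>) auto
qed

lemma upper_hitting_prob_eq:
  "upper_hitting_prob \<tau> Q \<T> A x = ereal (reach_limit (upper_mean \<T>) 1 A x)"
proof -
  let ?p = "reach_limit (upper_mean \<T>) 1 A"
  let ?V = "upper_expectation_V Q \<T> (\<lambda>\<omega>. ereal (hitting_indicator A \<omega>)) [x]"
  let ?I = "SUP P\<in>processes_I \<T>. ereal (cond_expectation P (hitting_indicator A) [x])"
  let ?H = "SUP P\<in>processes_H \<T>. ereal (cond_expectation P (hitting_indicator A) [x])"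
  have "?V \<le> ereal (?p x)"
  proof (rule upper_V_hitting_le_supersolution)
    show "0 \<le> ?p x" for x by (rule upper.reach_limit_nonneg) auto
    show "(if x \<in> A then 1 else upper_mean \<T> ?p x) \<le> ?p x" for x
      using upper.reach_limit_fixed_point[of 1 A x] by auto
  qed
  moreover have "?I \<le> ?V"
    by (intro SUP_least hitting_expectation_le_upper_V)
  moreover have "?H \<le> ?I"
    by (intro SUP_subset_mono processes_H_subset_I order_refl)
  moreover have "ereal (?p x) \<le> ?H"
    by (rule reach_limit_le_SUP_processes_H)
  ultimately show ?thesis
    unfolding upper_hitting_prob_def by (cases \<tau>) auto
qed

end

text \<open>
  Real-valued solutions in the sense of extended reals are exactly the embeddings of real functions,
  so minimality among them reduces to the least fixed point property of the real operator.
\<close>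

lemma (in average_operator) minimal_nonneg_solution_reach_limit:
  assumes G: "\<And>f x. G (\<lambda>y. ereal (f y)) x = ereal (F f x)"
  shows "minimal_nonneg_solution (\<lambda>p x. indicator A x + indicator (- A) x * G p x)
    (\<lambda>x. ereal (reach_limit F 1 A x))"
  unfolding minimal_nonneg_solution_def
proof (intro conjI ballI allI impI)
  let ?p = "reach_limit F 1 A"
  have eq: "indicator A x + indicator (- A) x * G (\<lambda>y. ereal (f y)) x =
      ereal (if x \<in> A then 1 else F f x)" for f x
    by (simp add: G indicator_def)
  show "(\<lambda>x. ereal (?p x)) \<in> real_functions" by (simp add: real_functions_def)
  show "0 \<le> ereal (?p x)" for x by (simp add: reach_limit_nonneg)
  show "ereal (?p x) = indicator A x + indicator (- A) x * G (\<lambda>x. ereal (?p x)) x" for x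
    unfolding eq using reach_limit_fixed_point[of 1 A x] by simp
  fix g x
  assume "g \<in> real_functions"
    and g: "(\<forall>x. 0 \<le> g x) \<and> (\<forall>x. g x = indicator A x + indicator (- A) x * G g x)"
  define r where "r y = real_of_ereal (g y)" for y
  have gr: "g = (\<lambda>y. ereal (r y))"
    using \<open>g \<in> real_functions\<close> by (auto simp: fun_eq_iff real_functions_def r_def ereal_real)
  have "?p x \<le> r x"
  proof (rule reach_limit_least)
    show "0 \<le> r y" for y using g by (simp add: gr)
    show "(if y \<in> A then 1 else 1 * F r y) \<le> r y" for y
      using g eq[of y r] unfolding gr by (metis ereal_less_eq(3) mult_1 order_refl)
  qed auto
  then show "ereal (?p x) \<le> g x" by (simp add: gr)
qed

theorem corollary19:
  fixes A :: "'x::finite set"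
    and \<T> :: "(real^'x^'x) set"
    and Q :: "('x \<Rightarrow> ereal) \<Rightarrow> ereal"
    and \<tau> :: chain_type
  assumes "\<forall>T\<in>\<T>. transition_matrix T"
    and "\<T> \<noteq> {}" and "closed \<T>" and "convex \<T>"
    and "separately_specified_rows \<T>"
    and "initial_upper_operator Q"
  shows "minimal_nonneg_solution
           (\<lambda>p x. indicator A x + indicator (- A) x * lower_trans \<T> p x)
           (lower_hitting_prob \<tau> Q \<T> A) \<and>
         minimal_nonneg_solution
           (\<lambda>p x. indicator A x + indicator (- A) x * upper_trans \<T> p x)
           (upper_hitting_prob \<tau> Q \<T> A)"
proof -
  interpret transition_set \<T>
    using assms by unfold_locales auto
  have "lower_hitting_prob \<tau> Q \<T> A = (\<lambda>x. ereal (reach_limit (lower_mean \<T>) 1 A x))"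
    and "upper_hitting_prob \<tau> Q \<T> A = (\<lambda>x. ereal (reach_limit (upper_mean \<T>) 1 A x))"
    by (simp_all add: fun_eq_iff lower_hitting_prob_eq upper_hitting_prob_eq)
  then show ?thesis
    using lower.minimal_nonneg_solution_reach_limit[of "lower_trans \<T>" A]
      upper.minimal_nonneg_solution_reach_limit[of "upper_trans \<T>" A]
    by (simp add: lower_trans_ereal upper_trans_ereal)
qed

end
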